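(* Let $K$ be a finite field, let $S=K[t_1,\ldots,t_s]$, let $X=\{P_1,\ldots,P_m\}\subset K^s$ be a set of $m\ge 2$ distinct points with vanishing ideal $I=I(X)\subset S$, and let $\prec$ be a monomial order on $S$. Let $\mathcal{L}\subset S$ be a $K$-linear subspace of finite dimension, let $\mathcal{L}_X\subset K^m$ be the corresponding evaluation code, and let $\mathcal{L}^\perp=(\ker(\varphi)\colon\mathcal{L})\cap K\Delta_\prec(I)$ be its algebraic dual. Then the dual code $(\mathcal{L}_X)^\perp$ is the standard evaluation code $(\mathcal{L}^\perp)_X$ on $X$ relative to $\prec$; that is, $\mathcal{L}^\perp$ is a linear subspace of $K\Delta_\prec(I)$ and $(\mathcal{L}_X)^\perp=(\mathcal{L}^\perp)_X$.
   Context: $I(X)$ is the ideal of all polynomials of $S$ vanishing at every point of $X$. For a monomial order $\prec$, $\Delta_\prec(I)$ is the set of standard monomials of $S/I$, i.e. the monomials of $S$ not in the initial ideal $\mathrm{in}_\prec(I)$, and $K\Delta_\prec(I)$ is its $K$-linear span in $S$. For a finite-dimensional linear subspace $\mathcal{L}\subset S$, the evaluation code is $\mathcal{L}_X=\{(f(P_1),\ldots,f(P_m)) : f\in\mathcal{L}\}\subset K^m$. It is called a standard evaluation code on $X$ relative to $\prec$ if $\mathcal{L}\subset K\Delta_\prec(I)$. For a linear code $C\subset K^m$, $C^\perp$ is the set of $\alpha\in K^m$ with $\langle\alpha,\beta\rangle=0$ for all $\beta\in C$, where $\langle\ ,\,\rangle$ is the ordinary inner product. $\varphi\colon S\to K$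 is the $K$-linear map $\varphi(f)=f(P_1)+\cdots+f(P_m)$, and $(\ker(\varphi)\colon\mathcal{L})=\{g\in S : g\mathcal{L}\subset\ker(\varphi)\}$. *)

theory Defs
  imports "HOL-Analysis.Cartesian_Space" "HOL-Library.Poly_Mapping"
begin

text \<open>
  The indeterminates $t_1,\ldots,t_s$ are indexed by a finite type \<open>'s\<close>; a monomial $t^a$ is
  represented by its exponent vector $a$, so multiplication of monomials is addition of exponents.
\<close>

type_synonym 's monom = "'s \<Rightarrow>\<^sub>0 nat"
type_synonym ('s, 'k) mpoly = "'s monom \<Rightarrow>\<^sub>0 'k"

definition monomial :: "'s monom \<Rightarrow> ('s, 'k::zero_neq_one) mpoly" where
  "monomial a = Poly_Mapping.single a 1"

definition mpoly_eval :: "('s::finite, 'k::comm_semiring_1) mpoly \<Rightarrow> 'k ^ 's \<Rightarrow> 'k" where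
  "mpoly_eval f x =
    (\<Sum>a\<in>Poly_Mapping.keys f.
      Poly_Mapping.lookup f a * (\<Prod>i\<in>UNIV. (x $ i) ^ Poly_Mapping.lookup a i))"

definition mpoly_scale :: "'k::comm_ring_1 \<Rightarrow> ('s, 'k) mpoly \<Rightarrow> ('s, 'k) mpoly" where
  "mpoly_scale c f = Poly_Mapping.single 0 c * f"

global_interpretation mpoly: vector_space "mpoly_scale :: 'k::field \<Rightarrow> ('s, 'k) mpoly \<Rightarrow> _"
  by unfold_locales
    (simp_all add: mpoly_scale_def distrib_left distrib_right single_add mult_single
      flip: mult.assoc)

text \<open>The polynomial ring as a module over itself: \<open>ideal.span A\<close> is the ideal generated by \<open>A\<close>.\<close>

global_interpretation ideal:
  module "(*) :: ('s, 'k::comm_ring_1) mpoly \<Rightarrow> ('s, 'k) mpoly \<Rightarrow> ('s, 'k) mpoly"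
  by unfold_locales (simp_all add: distrib_left distrib_right mult.assoc)

definition finite_dimensional :: "('s, 'k::field) mpoly set \<Rightarrow> bool" where
  "finite_dimensional L \<longleftrightarrow> (\<exists>B. finite B \<and> L = mpoly.span B)"

text \<open>
  \<open>(a, b) \<in> ord\<close> means $t^a \preceq t^b$. In the presence of the other two conditions,
  well-foundedness is equivalent (Dickson) to $1$ being the least monomial.
\<close>

definition monomial_order :: "('s monom \<times> 's monom) set \<Rightarrow> bool" where
  "monomial_order ord \<longleftrightarrow>
    well_order_on UNIV ord \<and> (\<forall>a b c. (a, b) \<in> ord \<longrightarrow> (a + c, b + c) \<in> ord)"

text \<open>The leading exponent is only meaningful for \<open>f \<noteq> 0\<close>.\<close>

definition lead_exp :: "('s monom \<times> 's monom) set \<Rightarrow> ('s, 'k::zero) mpoly \<Rightarrow> 's monom" where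
  "lead_exp ord f =
    (THE a. a \<in> Poly_Mapping.keys f \<and> (\<forall>b\<in>Poly_Mapping.keys f. (b, a) \<in> ord))"

definition initial_ideal ::
    "('s monom \<times> 's monom) set \<Rightarrow> ('s, 'k::comm_ring_1) mpoly set \<Rightarrow> ('s, 'k) mpoly set" where
  "initial_ideal ord I = ideal.span {monomial (lead_exp ord f) | f. f \<in> I \<and> f \<noteq> 0}"

definition standard_monomials ::
    "('s monom \<times> 's monom) set \<Rightarrow> ('s, 'k::comm_ring_1) mpoly set \<Rightarrow> ('s, 'k) mpoly set" where
  "standard_monomials ord I = {monomial a | a. monomial a \<notin> initial_ideal ord I}"

definition standard_span ::
    "('s monom \<times> 's monom) set \<Rightarrow> ('s, 'k::field) mpoly set \<Rightarrow> ('s, 'k) mpoly set" where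
  "standard_span ord I = mpoly.span (standard_monomials ord I)"

definition vanishing_ideal :: "('k::comm_ring_1 ^ 's::finite) set \<Rightarrow> ('s, 'k) mpoly set" where
  "vanishing_ideal X = {f. \<forall>x\<in>X. mpoly_eval f x = 0}"

text \<open>
  The points $P_1,\ldots,P_m$ are a family indexed by a finite type \<open>'m\<close>; the set $X$ is
  \<open>range P\<close> and $K^m$ is \<open>'k ^ 'm\<close>.
\<close>

definition evaluation_code ::
    "('m::finite \<Rightarrow> 'k::comm_ring_1 ^ 's::finite) \<Rightarrow> ('s, 'k) mpoly set \<Rightarrow> ('k ^ 'm) set" where
  "evaluation_code P L = {(\<chi> i. mpoly_eval f (P i)) | f. f \<in> L}"

definition standard_evaluation_code ::
    "('s monom \<times> 's monom) set \<Rightarrow> ('m::finite \<Rightarrow> 'k::field ^ 's::finite) \<Rightarrow> ('k ^ 'm) set \<Rightarrow> bool"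
  where
  "standard_evaluation_code ord P C \<longleftrightarrow>
    (\<exists>L. mpoly.subspace L \<and> finite_dimensional L
       \<and> L \<subseteq> standard_span ord (vanishing_ideal (range P)) \<and> C = evaluation_code P L)"

definition dual_code :: "('k::comm_ring_1 ^ 'm::finite) set \<Rightarrow> ('k ^ 'm) set" where
  "dual_code C = {\<alpha>. \<forall>\<beta>\<in>C. (\<Sum>i\<in>UNIV. \<alpha> $ i * \<beta> $ i) = 0}"

definition point_sum ::
    "('m::finite \<Rightarrow> 'k::comm_ring_1 ^ 's::finite) \<Rightarrow> ('s, 'k) mpoly \<Rightarrow> 'k" where
  "point_sum P f = (\<Sum>i\<in>UNIV. mpoly_eval f (P i))"

definition colon :: "('s, 'k::comm_ring_1) mpoly set \<Rightarrow> ('s, 'k) mpoly set \<Rightarrow> ('s, 'k) mpoly set"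
  where
  "colon A L = {g. \<forall>f\<in>L. g * f \<in> A}"

definition algebraic_dual ::
    "('s monom \<times> 's monom) set \<Rightarrow> ('m::finite \<Rightarrow> 'k::field ^ 's::finite)
      \<Rightarrow> ('s, 'k) mpoly set \<Rightarrow> ('s, 'k) mpoly set" where
  "algebraic_dual ord P L =
    colon {f. point_sum P f = 0} L \<inter> standard_span ord (vanishing_ideal (range P))"

end

theory Submission
  imports Defs
begin

text \<open>
  Write \<open>ev g\<close> for the vector of values of a polynomial \<open>g\<close> at the points, and \<open>I\<close> for their
  vanishing ideal. Evaluation at a point is multiplicative, so the inner product of \<open>ev g\<close> and
  \<open>ev f\<close> is \<open>point_sum P (g * f)\<close>; hence \<open>ev g\<close> lies in the dual code of \<open>L\<close> exactly if \<open>g\<close>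
  multiplies \<open>L\<close> into the kernel of \<open>point_sum P\<close> (\<open>dual_code_iff_colon\<close>). The algebraic dual
  therefore evaluates to precisely those dual codewords that are values of some element of
  \<open>standard_span ord I\<close>, and the claim is that every vector is such a value.

  That follows from two facts. The points are distinct, so every vector is \<open>ev f\<close> for some
  polynomial \<open>f\<close> (\<open>interpolation\<close>). And \<open>f\<close> can be replaced by its remainder in
  \<open>standard_span ord I\<close> without changing its values, since every polynomial is congruent modulo
  an ideal to a combination of standard monomials (\<open>standard_remainder\<close>).

  Conversely no nonzero combination of standard monomials lies in the ideal
  (\<open>standard_span_inter_ideal\<close>), so \<open>ev\<close> is injective on \<open>standard_span ord I\<close>. Over a finite
  field this makes the span a finite set, and every subspace of it is finite-dimensional, being
  spanned by itself.
\<close>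

section \<open>Evaluation is a ring homomorphism\<close>

lemma monomial_expansion:
  fixes f :: "('s, 'k::field) mpoly"
  shows "f = (\<Sum>a\<in>Poly_Mapping.keys f. mpoly_scale (Poly_Mapping.lookup f a) (monomial a))"
  by (rule poly_mapping_eqI)
    (simp add: lookup_sum mpoly_scale_def monomial_def mult_single lookup_single when_def
      in_keys_iff)

text \<open>
  This reduces the claims below that are linear in a polynomial, namely multiplicativity of
  evaluation and existence of remainders, to monomials.
\<close>
lemma in_subspace_if_monomials_in:
  fixes f :: "('s, 'k::field) mpoly"
  assumes "mpoly.subspace V" and "\<And>a. a \<in> Poly_Mapping.keys f \<Longrightarrow> monomial a \<in> V"
  shows "f \<in> V"
  using assms by (subst monomial_expansion) (blast intro: mpoly.subspace_sum mpoly.subspace_scale)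

text \<open>
  Sums and scalar multiples can lose monomials by cancellation. Summing over a larger finite set
  of exponents lets all the polynomials involved share one index set.
\<close>
lemma mpoly_eval_eq_sum:
  assumes "finite A" and "Poly_Mapping.keys f \<subseteq> A"
  shows "mpoly_eval f x =
    (\<Sum>a\<in>A. Poly_Mapping.lookup f a * (\<Prod>i\<in>UNIV. (x $ i) ^ Poly_Mapping.lookup a i))"
  unfolding mpoly_eval_def using assms by (intro sum.mono_neutral_left) (auto simp: in_keys_iff)

lemma mpoly_eval_add: "mpoly_eval (f + g) x = mpoly_eval f x + mpoly_eval g x"
proof -
  let ?A = "Poly_Mapping.keys f \<union> Poly_Mapping.keys g"
  have "mpoly_eval h x =
      (\<Sum>a\<in>?A. Poly_Mapping.lookup h a * (\<Prod>i\<in>UNIV. (x $ i) ^ Poly_Mapping.lookup a i))"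
    if "h \<in> {f, g, f + g}" for h
    using that keys_add[of f g] by (intro mpoly_eval_eq_sum) auto
  then show ?thesis
    by (simp add: lookup_add distrib_right sum.distrib)
qed

lemma mpoly_eval_0 [simp]: "mpoly_eval 0 x = 0"
  by (simp add: mpoly_eval_def)

lemma mpoly_eval_single:
  "mpoly_eval (Poly_Mapping.single a c) x = c * (\<Prod>i\<in>UNIV. (x $ i) ^ Poly_Mapping.lookup a i)"
  by (subst mpoly_eval_eq_sum[where A = "{a}"]) auto

lemma lookup_mpoly_scale:
  fixes f :: "('s, 'k::field) mpoly"
  shows "Poly_Mapping.lookup (mpoly_scale c f) a = c * Poly_Mapping.lookup f a"
proof -
  have "mpoly_scale c f =
      (\<Sum>b\<in>Poly_Mapping.keys f. mpoly_scale (c * Poly_Mapping.lookup f b) (monomial b))"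
    using arg_cong[OF monomial_expansion[of f], of "mpoly_scale c"]
    by (simp add: mpoly.scale_sum_right)
  then show ?thesis
    by (simp add: lookup_sum mpoly_scale_def monomial_def mult_single lookup_single when_def
      in_keys_iff)
qed

lemma mpoly_eval_scale:
  fixes f :: "('s::finite, 'k::field) mpoly"
  shows "mpoly_eval (mpoly_scale c f) x = c * mpoly_eval f x"
proof -
  have "mpoly_eval (mpoly_scale c f) x = (\<Sum>a\<in>Poly_Mapping.keys f.
      Poly_Mapping.lookup (mpoly_scale c f) a * (\<Prod>i\<in>UNIV. (x $ i) ^ Poly_Mapping.lookup a i))"
    by (rule mpoly_eval_eq_sum) (auto simp: in_keys_iff lookup_mpoly_scale)
  then show ?thesis
    by (simp add: mpoly_eval_def lookup_mpoly_scale sum_distrib_left mult.assoc)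
qed

lemma mpoly_scale_mult_left:
  "mpoly_scale c f * g = mpoly_scale c (f * g)"
  unfolding mpoly_scale_def by (rule mult.assoc)

lemma mpoly_scale_mult_right:
  "f * mpoly_scale c g = mpoly_scale c (f * g)"
  unfolding mpoly_scale_def by (rule mult.left_commute)

lemma mpoly_eval_mult:
  fixes f g :: "('s::finite, 'k::field) mpoly"
  shows "mpoly_eval (f * g) x = mpoly_eval f x * mpoly_eval g x"
proof -
  have sub_left: "mpoly.subspace {p. mpoly_eval (p * q) x = mpoly_eval p x * mpoly_eval q x}"
    for q :: "('s, 'k) mpoly"
    by (rule mpoly.subspaceI)
      (simp_all add: mpoly_eval_add mpoly_eval_scale mpoly_scale_mult_left distrib_right mult.assoc)
  have sub_right: "mpoly.subspace {q. mpoly_eval (p * q) x = mpoly_eval p x * mpoly_eval q x}"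
    for p :: "('s, 'k) mpoly"
    by (rule mpoly.subspaceI)
      (simp_all add: mpoly_eval_add mpoly_eval_scale mpoly_scale_mult_right distrib_left mult.left_commute)
  have "mpoly_eval (monomial a * monomial b :: ('s, 'k) mpoly) x =
      mpoly_eval (monomial a) x * mpoly_eval (monomial b) x" for a b
    by (simp add: monomial_def mult_single mpoly_eval_single lookup_add power_add prod.distrib)
  then have "mpoly_eval (monomial a * g) x = mpoly_eval (monomial a) x * mpoly_eval g x" for a
    using in_subspace_if_monomials_in[OF sub_right] by blast
  then show ?thesis
    using in_subspace_if_monomials_in[OF sub_left] by blast
qed

lemma mpoly_eval_const: "mpoly_eval (Poly_Mapping.single 0 c) x = c"
  by (simp add: mpoly_eval_single)

lemma mpoly_eval_prod:
  fixes f :: "'a \<Rightarrow> ('s::finite, 'k::field) mpoly"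
  shows "mpoly_eval (prod f A) x = (\<Prod>j\<in>A. mpoly_eval (f j) x)"
  using mpoly_eval_const[of 1 x]
  by (induction A rule: infinite_finite_induct) (simp_all add: mpoly_eval_mult)

lemma mpoly_eval_sum: "mpoly_eval (sum f A) x = (\<Sum>j\<in>A. mpoly_eval (f j) x)"
  by (induction A rule: infinite_finite_induct) (simp_all add: mpoly_eval_add)

lemma mpoly_eval_diff:
  fixes f g :: "('s::finite, 'k::field) mpoly"
  shows "mpoly_eval (f - g) x = mpoly_eval f x - mpoly_eval g x"
  using mpoly_eval_add[of "f - g" g x] by simp

lemma vanishing_ideal_ideal:
  "ideal.subspace (vanishing_ideal (X :: ('k::field ^ 's::finite) set))"
  by (rule ideal.subspaceI) (auto simp: vanishing_ideal_def mpoly_eval_add mpoly_eval_mult)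

section \<open>Interpolation\<close>

text \<open>
  Two distinct points differ in some coordinate \<open>k\<close>; normalising the variable of index \<open>k\<close> by an
  affine map makes it \<open>1\<close> at \<open>x\<close> and \<open>0\<close> at \<open>y\<close>.
\<close>
lemma separating_polynomial:
  fixes x y :: "'k::field ^ 's::finite"
  assumes "x \<noteq> y"
  obtains f :: "('s, 'k) mpoly" where "mpoly_eval f x = 1" and "mpoly_eval f y = 0"
proof -
  obtain k where k: "x $ k \<noteq> y $ k"
    using assms by (auto simp: vec_eq_iff)
  let ?t = "Poly_Mapping.single (Poly_Mapping.single k 1) 1 :: ('s, 'k) mpoly"
  have t: "mpoly_eval ?t z = z $ k" for z
  proof -
    have "(\<Prod>i\<in>UNIV. (z $ i) ^ Poly_Mapping.lookup (Poly_Mapping.single k 1) i) =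
        (\<Prod>i\<in>UNIV. if i = k then z $ i else 1)"
      by (intro prod.cong) (auto simp: lookup_single when_def)
    then show ?thesis
      by (simp add: mpoly_eval_single)
  qed
  let ?f = "mpoly_scale (inverse (x $ k - y $ k)) (?t - Poly_Mapping.single 0 (y $ k))"
  show ?thesis
    by (rule that[of ?f])
      (use k in \<open>simp_all only: mpoly_eval_scale mpoly_eval_diff t mpoly_eval_const, simp_all\<close>)
qed

text \<open>
  Lagrange interpolation: the product over \<open>j \<noteq> i\<close> of polynomials that separate the \<open>i\<close>-th
  point from the \<open>j\<close>-th is \<open>1\<close> at the \<open>i\<close>-th point and \<open>0\<close> at all the others.
\<close>
lemma interpolation:
  fixes P :: "'m::finite \<Rightarrow> 'k::field ^ 's::finite"
  assumes "inj P"
  obtains f :: "('s, 'k) mpoly" where "\<And>i. mpoly_eval f (P i) = v i"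
proof -
  have "\<exists>f :: ('s, 'k) mpoly. i \<noteq> j \<longrightarrow> mpoly_eval f (P i) = 1 \<and> mpoly_eval f (P j) = 0" for i j
    using separating_polynomial[of "P i" "P j"] injD[OF assms, of i j] by metis
  then obtain h :: "'m \<Rightarrow> 'm \<Rightarrow> ('s, 'k) mpoly" where h:
    "\<And>i j. i \<noteq> j \<Longrightarrow> mpoly_eval (h i j) (P i) = 1 \<and> mpoly_eval (h i j) (P j) = 0"
    by metis
  define e where "e i = (\<Prod>j\<in>- {i}. h i j)" for i
  have e: "mpoly_eval (e i) (P j) = (if i = j then 1 else 0)" for i j
    by (auto simp: e_def mpoly_eval_prod h intro!: prod.neutral prod_zero bexI[of _ j])
  show ?thesis
    by (rule that[of "\<Sum>i\<in>UNIV. mpoly_scale (v i) (e i)"])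
      (simp add: mpoly_eval_sum mpoly_eval_scale e if_distrib cong: if_cong)
qed

section \<open>Standard monomials are a basis modulo the ideal\<close>

lemma
  assumes "monomial_order ord" and "f \<noteq> 0"
  shows lead_exp_in_keys: "lead_exp ord f \<in> Poly_Mapping.keys f"
    and lead_exp_greatest: "b \<in> Poly_Mapping.keys f \<Longrightarrow> (b, lead_exp ord f) \<in> ord"
proof -
  have lin: "refl ord" "trans ord" "antisym ord" "total ord"
    using assms(1)
    by (auto simp: monomial_order_def order_on_defs)
  have "\<exists>a\<in>A. \<forall>b\<in>A. (b, a) \<in> ord" if "finite A" "A \<noteq> {}" for A
    using that
  proof (induction rule: finite_ne_induct)
    case (singleton a)
    then show ?case using lin by (auto simp: refl_on_def)
  next
    case (insert c A)
    then obtain a where a: "a \<in> A" "\<forall>b\<in>A. (b, a) \<in> ord" by blast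
    show ?case
    proof (cases "(c, a) \<in> ord")
      case True
      then show ?thesis using a by blast
    next
      case False
      then have "(a, c) \<in> ord" "(c, c) \<in> ord"
        using lin by (metis UNIV_I refl_on_def total_on_def)+
      moreover have "(b, c) \<in> ord" if "b \<in> A" for b
        using a that \<open>(a, c) \<in> ord\<close> lin(2) by (meson transD)
      ultimately show ?thesis by blast
    qed
  qed
  then have "\<exists>a. a \<in> Poly_Mapping.keys f \<and> (\<forall>b\<in>Poly_Mapping.keys f. (b, a) \<in> ord)"
    using assms(2) by (metis finite_keys keys_eq_empty)
  then have "\<exists>!a. a \<in> Poly_Mapping.keys f \<and> (\<forall>b\<in>Poly_Mapping.keys f. (b, a) \<in> ord)"
    using lin(3) by (metis antisymD)
  from theI'[OF this]
  show "lead_exp ord f \<in> Poly_Mapping.keys f"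
    and "b \<in> Poly_Mapping.keys f \<Longrightarrow> (b, lead_exp ord f) \<in> ord"
    unfolding lead_exp_def by blast+
qed

lemma keys_standard_span:
  assumes "f \<in> standard_span ord I" and "a \<in> Poly_Mapping.keys f"
  shows "monomial a \<notin> initial_ideal ord I"
proof -
  let ?V = "{f. \<forall>a\<in>Poly_Mapping.keys f. monomial a \<notin> initial_ideal ord I}"
  have "mpoly.subspace ?V"
  proof (rule mpoly.subspaceI)
    show "g + h \<in> ?V" if "g \<in> ?V" "h \<in> ?V" for g h
      using that keys_add[of g h] by blast
  qed (auto simp: in_keys_iff lookup_mpoly_scale)
  moreover have "standard_monomials ord I \<subseteq> ?V"
    by (auto simp: standard_monomials_def monomial_def)
  ultimately have "standard_span ord I \<subseteq> ?V"
    unfolding standard_span_def by (rule mpoly.span_minimal[rotated])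
  then show ?thesis using assms by blast
qed

text \<open>
  The leading monomial of a nonzero \<open>f\<close> in the ideal lies in the initial ideal, whereas all
  monomials of an element of the standard span lie outside it.
\<close>
lemma standard_span_inter_ideal:
  assumes "monomial_order ord" and "f \<in> standard_span ord I" and "f \<in> I"
  shows "f = 0"
proof (rule ccontr)
  assume "f \<noteq> 0"
  then have "monomial (lead_exp ord f) \<in> initial_ideal ord I"
    using assms(3) unfolding initial_ideal_def by (intro ideal.span_base) blast
  then show False
    using keys_standard_span[OF assms(2) lead_exp_in_keys[OF assms(1) \<open>f \<noteq> 0\<close>]] by blast
qed

text \<open>
  The initial ideal is generated by monomials, and the polynomials all of whose monomials are
  divisible by one of a given set of monomials already form an ideal.
\<close>
lemma keys_initial_ideal:
  assumes "h \<in> initial_ideal ord I" and "a \<in> Poly_Mapping.keys h"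
  obtains c f where "f \<in> I" and "f \<noteq> 0" and "a = c + lead_exp ord f"
proof -
  let ?V = "{h. \<forall>a\<in>Poly_Mapping.keys h. \<exists>c f. f \<in> I \<and> f \<noteq> 0 \<and> a = c + lead_exp ord f}"
  have "ideal.subspace ?V"
  proof (rule ideal.subspaceI)
    show "0 \<in> ?V" by simp
    show "g + h \<in> ?V" if "g \<in> ?V" "h \<in> ?V" for g h
      using that keys_add[of g h] by blast
    show "g * h \<in> ?V" if "h \<in> ?V" for g h
      using that keys_mult[of g h] by (auto simp: subset_iff) (metis add.assoc)
  qed
  moreover have "{monomial (lead_exp ord f) | f. f \<in> I \<and> f \<noteq> 0} \<subseteq> ?V"
    by (auto simp: monomial_def) (metis add_0)
  ultimately have "initial_ideal ord I \<subseteq> ?V"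
    unfolding initial_ideal_def by (rule ideal.span_minimal[rotated])
  then show ?thesis using assms that by blast
qed

text \<open>
  This is division with remainder. By linearity it suffices to reduce a single monomial, by
  well-founded induction along the order: a nonstandard monomial is the leading monomial of a
  monomial multiple of some \<open>f\<close> in the ideal, so modulo the ideal it is a combination of smaller
  monomials.
\<close>
lemma standard_remainder:
  fixes I :: "('s, 'k::field) mpoly set"
  assumes ord: "monomial_order ord" and I: "ideal.subspace I"
  obtains r where "r \<in> standard_span ord I" and "f - r \<in> I"
proof -
  let ?R = "{f. \<exists>r\<in>standard_span ord I. f - r \<in> I}"
  have std: "mpoly.subspace (standard_span ord I)"
    by (simp add: standard_span_def)
  have R: "mpoly.subspace ?R"
  proof (rule mpoly.subspaceI)
    show "0 \<in> ?R"
      using mpoly.subspace_0[OF std] ideal.subspace_0[OF I] by (auto intro!: bexI[of _ 0])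
  next
    fix f g assume "f \<in> ?R" "g \<in> ?R"
    then obtain r q where "r \<in> standard_span ord I" "q \<in> standard_span ord I"
        "f - r \<in> I" "g - q \<in> I"
      by blast
    then have "r + q \<in> standard_span ord I" "(f + g) - (r + q) \<in> I"
      using mpoly.subspace_add[OF std] ideal.subspace_add[OF I, of "f - r" "g - q"]
      by (auto simp: algebra_simps)
    then show "f + g \<in> ?R" by blast
  next
    fix c f assume "f \<in> ?R"
    then obtain r where "r \<in> standard_span ord I" "f - r \<in> I"
      by blast
    then have "mpoly_scale c r \<in> standard_span ord I" "mpoly_scale c f - mpoly_scale c r \<in> I"
      using mpoly.subspace_scale[OF std]
        ideal.subspace_scale[OF I, of "f - r" "Poly_Mapping.single 0 c"]
      by (auto simp: mpoly_scale_def algebra_simps)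
    then show "mpoly_scale c f \<in> ?R" by blast
  qed
  have I_R: "g \<in> ?R" if "g \<in> I" for g
    using that mpoly.subspace_0[OF std] by (auto intro!: bexI[of _ 0])
  have "wf (ord - Id)"
    using ord by (simp add: monomial_order_def well_order_on_def)
  then have mono: "monomial a \<in> ?R" for a
  proof (induction a rule: wf_induct_rule)
    case (less a)
    show ?case
    proof (cases "monomial a \<in> initial_ideal ord I")
      case False
      then have "monomial a \<in> standard_span ord I"
        unfolding standard_span_def standard_monomials_def by (intro mpoly.span_base) blast
      then show ?thesis
        using ideal.subspace_0[OF I] by (auto intro!: bexI[of _ "monomial a"])
    next
      case True
      then obtain c f where f: "f \<in> I" "f \<noteq> 0" and a: "a = c + lead_exp ord f"
        by (rule keys_initial_ideal[where a = a]) (simp add: monomial_def)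
      define l where "l = Poly_Mapping.lookup f (lead_exp ord f)"
      have "l \<noteq> 0"
        using lead_exp_in_keys[OF ord f(2)] by (simp add: l_def in_keys_iff)
      \<comment> \<open>The tail of \<open>f\<close>. Its multiple by the monomial with exponent \<open>c\<close> has only monomials
        below \<open>a\<close>, to which the induction hypothesis applies.\<close>
      define h where "h = f - mpoly_scale l (monomial (lead_exp ord f))"
      have "monomial c * h \<in> ?R"
      proof (rule in_subspace_if_monomials_in[OF R])
        fix b assume "b \<in> Poly_Mapping.keys (monomial c * h)"
        then obtain d where d: "d \<in> Poly_Mapping.keys h" "b = c + d"
          using keys_mult[of "monomial c :: ('s, 'k) mpoly" h] by (auto simp: monomial_def)
        then have "d \<in> Poly_Mapping.keys f" "d \<noteq> lead_exp ord f"
          by (auto simp: h_def l_def in_keys_iff lookup_minus lookup_mpoly_scale monomial_def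
              lookup_single when_def split: if_splits)
        moreover have "(c + d, c + e) \<in> ord" if "(d, e) \<in> ord" for e
          using that ord unfolding monomial_order_def by (metis add.commute)
        ultimately have "(b, a) \<in> ord - Id"
          using lead_exp_greatest[OF ord f(2)] a d(2) by auto
        then show "monomial b \<in> ?R" by (rule less.IH)
      qed
      moreover have "monomial c * f \<in> ?R"
        using ideal.subspace_scale[OF I f(1)] by (rule I_R)
      ultimately have "mpoly_scale (inverse l) (monomial c * f - monomial c * h) \<in> ?R"
        by (intro mpoly.subspace_scale[OF R] mpoly.subspace_diff[OF R])
      moreover have "monomial c * f - monomial c * h = mpoly_scale l (monomial a)"
        by (simp add: h_def algebra_simps a mpoly_scale_mult_right)
          (simp add: monomial_def mult_single add.commute)
      ultimately show ?thesis
        using \<open>l \<noteq> 0\<close> by simp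
    qed
  qed
  show ?thesis
    using in_subspace_if_monomials_in[OF R mono] that by blast
qed

section \<open>The dual of an evaluation code\<close>

text \<open>
  A combination of standard monomials is determined by its values on \<open>X\<close>, and there are only
  finitely many functions from \<open>X\<close> to a finite field.
\<close>
lemma finite_standard_span_vanishing:
  fixes X :: "('k::{field,finite} ^ 's::finite) set"
  assumes "monomial_order ord"
  shows "finite (standard_span ord (vanishing_ideal X))"
proof (rule inj_on_finite)
  let ?ev = "\<lambda>f. restrict (mpoly_eval f) X"
  show "inj_on ?ev (standard_span ord (vanishing_ideal X))"
  proof (rule inj_onI)
    fix f g assume *: "f \<in> standard_span ord (vanishing_ideal X)"
      "g \<in> standard_span ord (vanishing_ideal X)" "?ev f = ?ev g"
    then have "f - g \<in> standard_span ord (vanishing_ideal X)"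
      unfolding standard_span_def by (intro mpoly.span_diff)
    moreover have "f - g \<in> vanishing_ideal X"
      using *(3) by (auto simp: vanishing_ideal_def mpoly_eval_diff) (metis restrict_apply')
    ultimately have "f - g = 0"
      by (rule standard_span_inter_ideal[OF assms])
    then show "f = g" by simp
  qed
  show "?ev ` standard_span ord (vanishing_ideal X) \<subseteq> X \<rightarrow>\<^sub>E UNIV"
    by auto
  show "finite (X \<rightarrow>\<^sub>E (UNIV :: 'k set))"
    by (simp add: finite_PiE)
qed

text \<open>Passing from an interpolating polynomial to its standard remainder keeps all values.\<close>
lemma standard_span_evaluates_onto:
  fixes P :: "'m::finite \<Rightarrow> 'k::field ^ 's::finite"
  assumes "inj P" and "monomial_order ord"
  shows "evaluation_code P (standard_span ord (vanishing_ideal (range P))) = UNIV"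
proof -
  have "v \<in> evaluation_code P (standard_span ord (vanishing_ideal (range P)))" for v
  proof -
    obtain f :: "('s, 'k) mpoly" where f: "\<And>i. mpoly_eval f (P i) = v $ i"
      using interpolation[OF assms(1), of "\<lambda>i. v $ i"] by blast
    obtain r where r: "r \<in> standard_span ord (vanishing_ideal (range P))"
      "f - r \<in> vanishing_ideal (range P)"
      using standard_remainder[OF assms(2) vanishing_ideal_ideal] by blast
    then have "v = (\<chi> i. mpoly_eval r (P i))"
      by (simp add: vec_eq_iff vanishing_ideal_def mpoly_eval_diff f)
    then show ?thesis
      using r(1) by (auto simp: evaluation_code_def)
  qed
  then show ?thesis by blast
qed

text \<open>
  Multiplicativity of evaluation turns the inner product of two evaluation vectors into the
  point sum of the product polynomial.
\<close>
lemma dual_code_iff_colon: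
  fixes P :: "'m::finite \<Rightarrow> 'k::field ^ 's::finite"
  shows "(\<chi> i. mpoly_eval g (P i)) \<in> dual_code (evaluation_code P L) \<longleftrightarrow>
    g \<in> colon {f. point_sum P f = 0} L"
  by (auto simp: dual_code_def evaluation_code_def colon_def point_sum_def mpoly_eval_mult)

lemma subspace_algebraic_dual: "mpoly.subspace (algebraic_dual ord P L)"
proof -
  have "mpoly.subspace (colon {f. point_sum P f = 0} L)"
    by (rule mpoly.subspaceI)
      (auto simp: colon_def point_sum_def mpoly_eval_add mpoly_eval_scale distrib_right
        sum.distrib mpoly_scale_mult_left simp flip: sum_distrib_left)
  then show ?thesis
    unfolding algebraic_dual_def standard_span_def
    by (intro mpoly.subspace_inter mpoly.subspace_span)
qed

theorem theorem3p5:
  fixes P :: "'m::finite \<Rightarrow> 'k::{field,finite} ^ 's::finite"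
    and ord :: "('s monom \<times> 's monom) set"
    and L :: "('s, 'k) mpoly set"
  assumes "inj P" and "CARD('m) \<ge> 2"
    and "monomial_order ord"
    and "mpoly.subspace L" and "finite_dimensional L"
  shows "mpoly.subspace (algebraic_dual ord P L)
    \<and> finite_dimensional (algebraic_dual ord P L)
    \<and> algebraic_dual ord P L \<subseteq> standard_span ord (vanishing_ideal (range P))
    \<and> dual_code (evaluation_code P L) = evaluation_code P (algebraic_dual ord P L)
    \<and> standard_evaluation_code ord P (dual_code (evaluation_code P L))"
proof -
  let ?D = "algebraic_dual ord P L"
  have sub: "mpoly.subspace ?D"
    by (rule subspace_algebraic_dual)
  have le: "?D \<subseteq> standard_span ord (vanishing_ideal (range P))"
    by (auto simp: algebraic_dual_def)
  have "finite ?D"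
    using finite_standard_span_vanishing[OF assms(3)] finite_subset[OF le] by blast
  moreover have "?D = mpoly.span ?D"
    by (rule mpoly.span_eq_iff[THEN iffD2, OF sub, symmetric])
  ultimately have fd: "finite_dimensional ?D"
    unfolding finite_dimensional_def by blast
  have dual: "dual_code (evaluation_code P L) = evaluation_code P ?D"
  proof
    show "evaluation_code P ?D \<subseteq> dual_code (evaluation_code P L)"
      unfolding evaluation_code_def[of P ?D]
      by (auto simp: algebraic_dual_def dual_code_iff_colon)
    show "dual_code (evaluation_code P L) \<subseteq> evaluation_code P ?D"
    proof
      fix \<alpha> assume \<alpha>: "\<alpha> \<in> dual_code (evaluation_code P L)"
      have "\<alpha> \<in> evaluation_code P (standard_span ord (vanishing_ideal (range P)))"
        using standard_span_evaluates_onto[OF assms(1,3)] by simp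
      then obtain g where g: "g \<in> standard_span ord (vanishing_ideal (range P))"
        "\<alpha> = (\<chi> i. mpoly_eval g (P i))"
        unfolding evaluation_code_def by blast
      then have "g \<in> ?D"
        using \<alpha> by (simp add: algebraic_dual_def dual_code_iff_colon)
      then show "\<alpha> \<in> evaluation_code P ?D"
        using g(2) unfolding evaluation_code_def by blast
    qed
  qed
  then show ?thesis
    using sub fd le unfolding standard_evaluation_code_def by blast
qed

end
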